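(* Let $(P,\le,{}',0,1)$ be a Boolean poset satisfying the Ascending Chain Condition and the Descending Chain Condition, let $T(x,y,z):=\operatorname{Min}U\big(\operatorname{Max}L(x,z),\operatorname{Max}L(x,y',z'),\operatorname{Max}L(x',y',z)\big)$ for $x,y,z\in P$, and let $\Theta$ be a reflexive binary relation on $P$ which is compatible with the binary operators $\operatorname{Max}L$ and $\operatorname{Min}U$ and with the unary operation $'$. Then $\Theta$ is a congruence on $(P,\le,{}',0,1)$.
   Context: For a poset $(P,\le)$ and $A\subseteq P$ let $L(A)=\{x\mid x\le y\ \forall y\in A\}$, $U(A)=\{x\mid y\le x\ \forall y\in A\}$; write $L(x,y)=L(\{x,y\})$, $L(x,y,z)$, $U(A,B,C)=U(A\cup B\cup C)$, $LU(A)=L(U(A))$, etc.; $\operatorname{Max}A$, $\operatorname{Min}A$ are the sets of maximal, minimal elements. A poset is distributive if $L(U(x,y),z)=LU(L(x,z),L(y,z))$ for all $x,y,z$. A complementation on a bounded poset $(P,\le,0,1)$ is a unary operation $'$ with $U(x,x')=\{1\}$ and $L(x,x')=\{0\}$; a Boolean poset is a distributive bounded poset with a complementation. A binary relation $R$ is compatible with a map $Q\colon P^2\to2^P$ if whenever $(a_1,b_1),(a_2,b_2)\in R$ there exist $a\in Q(a_1,a_2)$, $b\in Q(b_1,b_2)$ with $(a,b)\in R$; it is compatible with $'$ if $(a,b)\in R$ implies $(a',b')\in R$. A congruence on a Boolean poset is an equivalence relation compatible with $(x,y)\mapsto\operatorname{Max}L(x,y)$, $(x,y)\mapsto\operatorname{Min}U(x,y)$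 and $'$. *)

theory Defs
  imports Main
begin

text \<open>
  A bounded poset is a type of class \<open>order_bot\<close> and \<open>order_top\<close>: the underlying set is the
  whole type, and the constants 0 and 1 are \<open>bot\<close> and \<open>top\<close>.
\<close>

definition lower_bounds :: "'a::order set \<Rightarrow> 'a set" where
  "lower_bounds A = {x. \<forall>y\<in>A. x \<le> y}"

definition upper_bounds :: "'a::order set \<Rightarrow> 'a set" where
  "upper_bounds A = {x. \<forall>y\<in>A. y \<le> x}"

definition maximal_elems :: "'a::order set \<Rightarrow> 'a set" where
  "maximal_elems A = {x \<in> A. \<not> (\<exists>y\<in>A. x < y)}"

definition minimal_elems :: "'a::order set \<Rightarrow> 'a set" where
  "minimal_elems A = {x \<in> A. \<not> (\<exists>y\<in>A. y < x)}"

definition distributive_poset :: "'a::order itself \<Rightarrow> bool" where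
  "distributive_poset (_ :: 'a itself) \<longleftrightarrow>
    (\<forall>x y z :: 'a.
      lower_bounds (upper_bounds {x, y} \<union> {z}) =
      lower_bounds (upper_bounds (lower_bounds {x, z} \<union> lower_bounds {y, z})))"

definition complementation :: "('a::{order_bot, order_top} \<Rightarrow> 'a) \<Rightarrow> bool" where
  "complementation c \<longleftrightarrow>
    (\<forall>x. upper_bounds {x, c x} = {top} \<and> lower_bounds {x, c x} = {bot})"

definition boolean_poset :: "('a::{order_bot, order_top} \<Rightarrow> 'a) \<Rightarrow> bool" where
  "boolean_poset c \<longleftrightarrow> distributive_poset TYPE('a) \<and> complementation c"

definition ascending_chain_condition :: "'a::order itself \<Rightarrow> bool" where
  "ascending_chain_condition (_ :: 'a itself) \<longleftrightarrow>
    \<not> (\<exists>f :: nat \<Rightarrow> 'a. \<forall>i. f i < f (Suc i))"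

definition descending_chain_condition :: "'a::order itself \<Rightarrow> bool" where
  "descending_chain_condition (_ :: 'a itself) \<longleftrightarrow>
    \<not> (\<exists>f :: nat \<Rightarrow> 'a. \<forall>i. f (Suc i) < f i)"

definition MaxL :: "'a::order \<Rightarrow> 'a \<Rightarrow> 'a set" where
  "MaxL x y = maximal_elems (lower_bounds {x, y})"

definition MinU :: "'a::order \<Rightarrow> 'a \<Rightarrow> 'a set" where
  "MinU x y = minimal_elems (upper_bounds {x, y})"

definition compatible_binary :: "('a \<times> 'a) set \<Rightarrow> ('a \<Rightarrow> 'a \<Rightarrow> 'a set) \<Rightarrow> bool" where
  "compatible_binary R Q \<longleftrightarrow>
    (\<forall>a1 b1 a2 b2. (a1, b1) \<in> R \<longrightarrow> (a2, b2) \<in> R \<longrightarrow>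
      (\<exists>a \<in> Q a1 a2. \<exists>b \<in> Q b1 b2. (a, b) \<in> R))"

definition compatible_unary :: "('a \<times> 'a) set \<Rightarrow> ('a \<Rightarrow> 'a) \<Rightarrow> bool" where
  "compatible_unary R c \<longleftrightarrow> (\<forall>a b. (a, b) \<in> R \<longrightarrow> (c a, c b) \<in> R)"

definition boolean_poset_congruence ::
  "('a::{order_bot, order_top} \<Rightarrow> 'a) \<Rightarrow> ('a \<times> 'a) set \<Rightarrow> bool" where
  "boolean_poset_congruence c R \<longleftrightarrow>
    equiv UNIV R \<and> compatible_binary R MaxL \<and> compatible_binary R MinU \<and> compatible_unary R c"

end

theory Submission
  imports Defs
begin

text \<open>
  The kernel \<open>{p. (p, 0) \<in> \<Theta>}\<close> is directed, because \<open>\<Theta>\<close> is compatible with \<open>Min U\<close>, so by the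
  Ascending Chain Condition it is a principal ideal \<open>L(e)\<close>. If \<open>(a, b) \<in> \<Theta>\<close>, then everything
  below \<open>a\<close> and \<open>b'\<close> lies in the kernel, and distributivity turns this into \<open>U(a, e) = U(b, e)\<close>.
  Applied to \<open>(m, x) \<in> \<Theta>\<close> with \<open>m \<in> Min U(x, e)\<close>, this makes \<open>m\<close> the supremum of \<open>x\<close> and \<open>e\<close>.
  Conversely, if \<open>U(a, e) = U(b, e)\<close>, then \<open>a\<close> and \<open>b\<close> have the same supremum \<open>m\<close> with \<open>e\<close>, and
  \<open>Max L\<close> of \<open>(a, m)\<close> and \<open>(m, b)\<close> is \<open>(a, b)\<close>. So \<open>\<Theta>\<close> relates the
  elements with equal sets \<open>U(x, e)\<close>.
\<close>

lemma lower_bounds_pair: "lower_bounds {x, y} = {..x} \<inter> {..y}"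
  by (auto simp: lower_bounds_def)

lemma upper_bounds_pair: "upper_bounds {x, y} = {x..} \<inter> {y..}"
  by (auto simp: upper_bounds_def)

lemma MaxL_absorb1: "x \<le> y \<Longrightarrow> MaxL x y = {x}"
  by (auto simp: MaxL_def maximal_elems_def lower_bounds_pair order.strict_iff_order)

lemma MaxL_absorb2: "y \<le> x \<Longrightarrow> MaxL x y = {y}"
  by (auto simp: MaxL_def maximal_elems_def lower_bounds_pair order.strict_iff_order)

lemma MaxL_disjoint:
  fixes x y :: "'a::order_bot"
  shows "lower_bounds {x, y} = {bot} \<Longrightarrow> MaxL x y = {bot}"
  by (auto simp: MaxL_def maximal_elems_def)

lemma MinU_eq_join: "upper_bounds {x, y} = {m..} \<Longrightarrow> MinU x y = {m}"
  by (auto simp: MinU_def minimal_elems_def order.strict_iff_order)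

lemma MinU_bot_left:
  fixes x :: "'a::order_bot"
  shows "MinU bot x = {x}"
  by (rule MinU_eq_join) (auto simp: upper_bounds_pair)

lemma MinU_ge:
  assumes "m \<in> MinU x y"
  shows "x \<le> m" and "y \<le> m"
  using assms by (auto simp: MinU_def minimal_elems_def upper_bounds_pair)

lemma compatible_binaryE:
  assumes "compatible_binary R Q" "(a1, b1) \<in> R" "(a2, b2) \<in> R"
  obtains a b where "a \<in> Q a1 a2" "b \<in> Q b1 b2" "(a, b) \<in> R"
  using assms unfolding compatible_binary_def by blast

lemma compatible_binary_singletons:
  assumes "compatible_binary R Q" "(a1, b1) \<in> R" "(a2, b2) \<in> R"
    and "Q a1 a2 = {a}" "Q b1 b2 = {b}"
  shows "(a, b) \<in> R"
  using assms by (auto elim: compatible_binaryE)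

lemma ascending_chain_condition_directed_has_greatest:
  fixes A :: "'a::order set"
  assumes acc: "ascending_chain_condition TYPE('a)"
    and "A \<noteq> {}"
    and directed: "\<And>x y. x \<in> A \<Longrightarrow> y \<in> A \<Longrightarrow> \<exists>z\<in>A. x \<le> z \<and> y \<le> z"
  obtains e where "e \<in> A" "\<And>x. x \<in> A \<Longrightarrow> x \<le> e"
proof -
  have "wf {(x, y :: 'a). y < x}"
    using acc by (simp add: wf_iff_no_infinite_down_chain ascending_chain_condition_def)
  then obtain e where "e \<in> A" and maximal: "\<And>y. e < y \<Longrightarrow> y \<notin> A"
    using \<open>A \<noteq> {}\<close> by (rule wfE_min') blast
  have "x \<le> e" if "x \<in> A" for x
  proof -
    obtain z where "z \<in> A" "x \<le> z" "e \<le> z"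
      using directed \<open>x \<in> A\<close> \<open>e \<in> A\<close> by blast
    then show ?thesis
      using maximal by (auto simp: order.order_iff_strict)
  qed
  then show thesis
    using \<open>e \<in> A\<close> that by blast
qed

lemma distributive_poset_le_cases:
  fixes x y z u :: "'a::order"
  assumes "distributive_poset TYPE('a)"
    and "z \<in> lower_bounds (upper_bounds {x, y})"
    and "\<And>t. t \<le> x \<Longrightarrow> t \<le> z \<Longrightarrow> t \<le> u"
    and "\<And>t. t \<le> y \<Longrightarrow> t \<le> z \<Longrightarrow> t \<le> u"
  shows "z \<le> u"
proof -
  have "z \<in> lower_bounds (upper_bounds {x, y} \<union> {z})"
    using assms(2) by (simp add: lower_bounds_def)
  also have "\<dots> = lower_bounds (upper_bounds (lower_bounds {x, z} \<union> lower_bounds {y, z}))"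
    using assms(1) by (simp add: distributive_poset_def)
  finally have "z \<in> lower_bounds (upper_bounds (lower_bounds {x, z} \<union> lower_bounds {y, z}))" .
  moreover have "u \<in> upper_bounds (lower_bounds {x, z} \<union> lower_bounds {y, z})"
    using assms(3,4) by (auto simp: upper_bounds_def lower_bounds_pair)
  ultimately show ?thesis
    by (auto simp: lower_bounds_def)
qed

locale boolean_poset_operation =
  fixes c :: "'a::{order_bot, order_top} \<Rightarrow> 'a"
  assumes boolean_poset: "boolean_poset c"
begin

lemma lower_bounds_compl: "lower_bounds {x, c x} = {bot}"
  and upper_bounds_compl: "upper_bounds {x, c x} = {top}"
  using boolean_poset by (auto simp: boolean_poset_def complementation_def)

lemma eq_bot_if_le_le_compl:
  assumes "t \<le> x" "t \<le> c x"
  shows "t = bot"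
proof -
  have "t \<in> lower_bounds {x, c x}"
    using assms by (simp add: lower_bounds_pair)
  then show ?thesis
    by (simp add: lower_bounds_compl)
qed

lemma disjoint_if_le_compl:
  assumes "y \<le> c x"
  shows "lower_bounds {x, y} = {bot}"
  using eq_bot_if_le_le_compl order_trans[OF _ assms] by (auto simp: lower_bounds_pair)

lemma compl_bot: "c bot = top"
proof -
  have "c bot \<in> upper_bounds {bot, c bot}"
    by (simp add: upper_bounds_pair)
  then show ?thesis
    by (simp add: upper_bounds_compl)
qed

lemma le_compl_cases:
  assumes "\<And>t. t \<le> x \<Longrightarrow> t \<le> z \<Longrightarrow> t \<le> u"
    and "\<And>t. t \<le> c x \<Longrightarrow> t \<le> z \<Longrightarrow> t \<le> u"
  shows "z \<le> u"
proof (rule distributive_poset_le_cases)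
  show "distributive_poset TYPE('a)"
    using boolean_poset by (simp add: boolean_poset_def)
  show "z \<in> lower_bounds (upper_bounds {x, c x})"
    by (simp add: upper_bounds_compl lower_bounds_def)
qed (fact assms)+

lemma le_compl_compl: "x \<le> c (c x)"
proof (rule le_compl_cases)
  show "t \<le> c (c x)" if "t \<le> c x" "t \<le> x" for t
    using eq_bot_if_le_le_compl[OF that(2,1)] by simp
qed

lemma upper_bounds_subset_if_difference_le:
  assumes "\<And>t. t \<le> a \<Longrightarrow> t \<le> c b \<Longrightarrow> t \<le> e"
  shows "upper_bounds {b, e} \<subseteq> upper_bounds {a, e}"
proof
  fix u assume "u \<in> upper_bounds {b, e}"
  then have "b \<le> u" "e \<le> u"
    by (simp_all add: upper_bounds_pair)
  have "a \<le> u"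
  proof (rule le_compl_cases)
    show "t \<le> u" if "t \<le> b" for t
      using that \<open>b \<le> u\<close> by (rule order_trans)
    show "t \<le> u" if "t \<le> c b" "t \<le> a" for t
      using assms[OF that(2,1)] \<open>e \<le> u\<close> by (rule order_trans)
  qed
  then show "u \<in> upper_bounds {a, e}"
    using \<open>e \<le> u\<close> by (simp add: upper_bounds_pair)
qed

end

locale compatible_reflexive_relation = boolean_poset_operation c
  for c :: "'a::{order_bot, order_top} \<Rightarrow> 'a" +
  fixes \<Theta> :: "('a \<times> 'a) set"
  assumes reflexive: "refl \<Theta>"
    and compatible_MaxL: "compatible_binary \<Theta> MaxL"
    and compatible_MinU: "compatible_binary \<Theta> MinU"
    and compatible_compl: "compatible_unary \<Theta> c"
begin

definition kernel :: "'a set" where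
  "kernel = {p. (p, bot) \<in> \<Theta>}"

lemma related_refl: "(x, x) \<in> \<Theta>"
  using reflexive by (simp add: refl_on_def)

lemma related_compl: "(a, b) \<in> \<Theta> \<Longrightarrow> (c a, c b) \<in> \<Theta>"
  using compatible_compl by (simp add: compatible_unary_def)

lemma difference_in_kernel:
  assumes "(a, b) \<in> \<Theta>" "t \<le> a" "t \<le> c b"
  shows "t \<in> kernel"
proof -
  have "MaxL a t = {t}" "MaxL b t = {bot}"
    using assms(2,3) by (simp_all add: MaxL_absorb2 MaxL_disjoint disjoint_if_le_compl)
  then show ?thesis
    unfolding kernel_def
    using compatible_binary_singletons[OF compatible_MaxL assms(1) related_refl] by simp
qed

lemma converse_difference_in_kernel:
  assumes "(a, b) \<in> \<Theta>" "t \<le> b" "t \<le> c a"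
  shows "t \<in> kernel"
  using related_compl[OF assms(1)] assms(3) order_trans[OF assms(2) le_compl_compl]
  by (rule difference_in_kernel)

lemma bot_related_kernel:
  assumes "t \<in> kernel"
  shows "(bot, t) \<in> \<Theta>"
proof (rule compatible_binary_singletons[OF compatible_MaxL])
  show "(c t, c bot) \<in> \<Theta>"
    using assms by (simp add: kernel_def related_compl)
  show "MaxL (c t) t = {bot}"
    using lower_bounds_compl[of t] by (simp add: MaxL_disjoint insert_commute)
  show "MaxL (c bot) t = {t}"
    by (simp add: compl_bot MaxL_absorb2)
qed (rule related_refl)

lemma kernel_directed:
  assumes "p \<in> kernel" "q \<in> kernel"
  shows "\<exists>r\<in>kernel. p \<le> r \<and> q \<le> r"
proof -
  have "(p, bot) \<in> \<Theta>" "(q, bot) \<in> \<Theta>"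
    using assms by (simp_all add: kernel_def)
  then obtain r where "r \<in> MinU p q" "(r, bot) \<in> \<Theta>"
    by (rule compatible_binaryE[OF compatible_MinU]) (simp add: MinU_bot_left)
  then show ?thesis
    using MinU_ge[of r p q] by (auto simp: kernel_def)
qed

lemma kernel_principal:
  assumes "ascending_chain_condition TYPE('a)"
  obtains e where "kernel = {..e}"
proof -
  have "bot \<in> kernel"
    by (simp add: kernel_def related_refl)
  then obtain e where "e \<in> kernel" and greatest: "\<And>p. p \<in> kernel \<Longrightarrow> p \<le> e"
    using ascending_chain_condition_directed_has_greatest[OF assms _ kernel_directed] by blast
  have "p \<in> kernel" if "p \<le> e" for p
    using difference_in_kernel[of e bot p] \<open>e \<in> kernel\<close> that by (simp add: kernel_def compl_bot)
  then have "kernel = {..e}"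
    using greatest by auto
  then show thesis
    by (rule that)
qed

lemma related_imp_upper_bounds_eq:
  assumes "kernel \<subseteq> {..e}" and "(a, b) \<in> \<Theta>"
  shows "upper_bounds {a, e} = upper_bounds {b, e}"
proof
  show "upper_bounds {b, e} \<subseteq> upper_bounds {a, e}"
    using difference_in_kernel[OF assms(2)] assms(1)
    by (intro upper_bounds_subset_if_difference_le) blast
  show "upper_bounds {a, e} \<subseteq> upper_bounds {b, e}"
    using converse_difference_in_kernel[OF assms(2)] assms(1)
    by (intro upper_bounds_subset_if_difference_le) blast
qed

lemma related_join_kernel_top:
  assumes "kernel = {..e}"
  obtains m where "upper_bounds {x, e} = {m..}" "(x, m) \<in> \<Theta>" "(m, x) \<in> \<Theta>"
proof -
  have "e \<in> kernel"
    using assms by simp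
  then have "(e, bot) \<in> \<Theta>"
    by (simp add: kernel_def)
  then obtain m where "m \<in> MinU e x" "(m, x) \<in> \<Theta>"
    using related_refl[of x]
    by (rule compatible_binaryE[OF compatible_MinU]) (simp add: MinU_bot_left)
  then have "upper_bounds {x, e} = upper_bounds {m, e}"
    using related_imp_upper_bounds_eq assms by blast
  also have "\<dots> = {m..}"
    using MinU_ge(1)[OF \<open>m \<in> MinU e x\<close>] by (auto simp: upper_bounds_pair)
  finally have join: "upper_bounds {x, e} = {m..}" .
  then have "MinU e x = {m}"
    by (simp add: MinU_eq_join insert_commute)
  then have "(x, m) \<in> \<Theta>"
    using compatible_binary_singletons[OF compatible_MinU bot_related_kernel[OF \<open>e \<in> kernel\<close>]
        related_refl MinU_bot_left] by blast
  then show thesis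
    using join \<open>(m, x) \<in> \<Theta>\<close> that by blast
qed

lemma upper_bounds_eq_imp_related:
  assumes "kernel = {..e}" and "upper_bounds {a, e} = upper_bounds {b, e}"
  shows "(a, b) \<in> \<Theta>"
proof -
  obtain m where join_a: "upper_bounds {a, e} = {m..}" and "(a, m) \<in> \<Theta>"
    using related_join_kernel_top[OF assms(1)] by metis
  obtain n where join_b: "upper_bounds {b, e} = {n..}" and "(n, b) \<in> \<Theta>"
    using related_join_kernel_top[OF assms(1)] by metis
  have "n = m"
    using join_a join_b assms(2) by simp
  have "a \<le> m" "b \<le> m"
    using join_a join_b \<open>n = m\<close> by (auto simp: upper_bounds_pair)
  then have "MaxL a m = {a}" "MaxL m b = {b}"
    by (simp_all add: MaxL_absorb1 MaxL_absorb2)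
  with \<open>(a, m) \<in> \<Theta>\<close> \<open>(n, b) \<in> \<Theta>\<close> show ?thesis
    unfolding \<open>n = m\<close> by (rule compatible_binary_singletons[OF compatible_MaxL])
qed

theorem equiv_if_ascending_chain_condition:
  assumes "ascending_chain_condition TYPE('a)"
  shows "equiv UNIV \<Theta>"
proof -
  obtain e where "kernel = {..e}"
    using kernel_principal[OF assms] .
  then have "(a, b) \<in> \<Theta> \<longleftrightarrow> upper_bounds {a, e} = upper_bounds {b, e}" for a b
    using related_imp_upper_bounds_eq upper_bounds_eq_imp_related by blast
  then show ?thesis
    by (auto intro!: equivI refl_onI symI transI)
qed

end

theorem theorem5p5:
  fixes c :: "'a::{order_bot, order_top} \<Rightarrow> 'a"
    and T :: "'a \<Rightarrow> 'a \<Rightarrow> 'a \<Rightarrow> 'a set"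
    and \<Theta> :: "('a \<times> 'a) set"
  assumes "boolean_poset c"
    and "ascending_chain_condition TYPE('a)"
    and "descending_chain_condition TYPE('a)"
    and "\<And>x y z. T x y z = minimal_elems (upper_bounds
          (maximal_elems (lower_bounds {x, z})
           \<union> maximal_elems (lower_bounds {x, c y, c z})
           \<union> maximal_elems (lower_bounds {c x, c y, z})))"
    and "refl \<Theta>"
    and "compatible_binary \<Theta> MaxL"
    and "compatible_binary \<Theta> MinU"
    and "compatible_unary \<Theta> c"
  shows "boolean_poset_congruence c \<Theta>"
proof -
  interpret compatible_reflexive_relation c \<Theta>
    using assms(1,5-8) by unfold_locales
  have "equiv UNIV \<Theta>"
    using assms(2) by (rule equiv_if_ascending_chain_condition)
  then show ?thesis
    using assms(6-8) by (simp add: boolean_poset_congruence_def)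
qed

end
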